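(* Let $T>0$, $t_1\in(0,T)$, $\Omega=(0,T)\times\mathbb{R}^n$, let $H(t,p)\in C^1([0,T]\times\mathbb{R}^n)$ and let $\sigma\in C^1(\mathbb{R}^n)$ be convex and Lipschitz. Suppose $H$ satisfies condition (A2) on $[0,t_1]\times\mathbb{R}^n$ and on $[t_1,T]\times\mathbb{R}^n$, and let $u$ be the layered viscosity solution $$u(t,x)=\begin{cases}\Big(\sigma^*+\int_0^tH(\tau,\cdot)\,d\tau\Big)^*(x), & t\in[0,t_1],\\[1ex] \Big(\omega^*+\int_{t_1}^tH(\tau,\cdot)\,d\tau\Big)^*(x), & t\in[t_1,T],\end{cases}\qquad \omega(x)=u(t_1,x).$$ Let $(t_0,x_0)\in\Sigma(u)$ and assume that the zero level set of $g(p,q)=p+H(t_0,q)$, $(p,q)\in\mathbb{R}\times\mathbb{R}^n$, contains no line segment $[(p_1,q_1),(p_2,q_2)]\subset\mathbb{R}^{n+1}$ with $(p_1,q_1)\ne(p_2,q_2)$. Then there exist $\rho>0$ and a Lipschitz arc $\mathbf x:[0,\rho]\to\mathbb{R}^{n+1}$ with $\mathbf x(0)=(t_0,x_0)$, $\mathbf x(s)\in\Sigma(u)$ for all $s\in(0,\rho)$, and $\mathbf x(s)\ne(t_0,x_0)$ for all sufficiently small $s>0$.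
   Context: $f^*(y)=\sup_q\{\langle y,q\rangle-f(q)\}$ is the Fenchel conjugate. Condition (A2) on $[a,b]\times\mathbb{R}^n$: either (a) $H(t,\cdot)$ is convex for all $t\in[a,b]$, or concave for all $t\in[a,b]$; or (b) $H(t,p)=g(t)h(p)+k(t)$ for some functions $g,h,k$ with $g$ not changing sign on $[a,b]$. $\Sigma(u)$ denotes the set of points of $\Omega$ at which $u$ is not differentiable. *)

theory Defs
  imports "HOL-Analysis.Analysis"
begin

definition fconj :: "('a::real_inner \<Rightarrow> ereal) \<Rightarrow> 'a \<Rightarrow> ereal" where
  "fconj f y = (SUP q. ereal (y \<bullet> q) - f q)"

definition C1_on :: "'a::real_normed_vector set \<Rightarrow> ('a \<Rightarrow> real) \<Rightarrow> bool" where
  "C1_on S f \<longleftrightarrow> (\<exists>f'. (\<forall>z\<in>S. (f has_derivative blinfun_apply (f' z)) (at z within S))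
                        \<and> continuous_on S f')"

definition condA2 :: "(real \<Rightarrow> 'a::real_vector \<Rightarrow> real) \<Rightarrow> real \<Rightarrow> real \<Rightarrow> bool" where
  "condA2 H a b \<longleftrightarrow>
     ((\<forall>t\<in>{a..b}. convex_on UNIV (H t)) \<or> (\<forall>t\<in>{a..b}. concave_on UNIV (H t)))
   \<or> (\<exists>g h k. (\<forall>t\<in>{a..b}. \<forall>p. H t p = g t * h p + k t)
             \<and> ((\<forall>t\<in>{a..b}. 0 \<le> g t) \<or> (\<forall>t\<in>{a..b}. g t \<le> 0)))"

definition hopf :: "('a::euclidean_space \<Rightarrow> real) \<Rightarrow> (real \<Rightarrow> 'a \<Rightarrow> real) \<Rightarrow> real \<Rightarrow> real \<Rightarrow> 'a \<Rightarrow> real" where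
  "hopf w H s t x =
     real_of_ereal (fconj (\<lambda>q. fconj (\<lambda>y. ereal (w y)) q + ereal (integral {s..t} (\<lambda>\<tau>. H \<tau> q))) x)"

definition layered_sol :: "(real \<Rightarrow> 'a::euclidean_space \<Rightarrow> real) \<Rightarrow> ('a \<Rightarrow> real) \<Rightarrow> real \<Rightarrow> real \<times> 'a \<Rightarrow> real" where
  "layered_sol H \<sigma> t1 = (\<lambda>(t, x).
     if t \<le> t1 then hopf \<sigma> H 0 t x
     else hopf (\<lambda>y. hopf \<sigma> H 0 t1 y) H t1 t x)"

definition Sing :: "real \<Rightarrow> (real \<times> 'a::real_normed_vector \<Rightarrow> real) \<Rightarrow> (real \<times> 'a) set" where
  "Sing T u = {z \<in> {0<..<T} \<times> UNIV. \<not> u differentiable (at z)}"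

end

theory Submission
  imports Defs
begin

text \<open>
  By the Hopf formula, \<open>u\<close> is on each layer the maximum of \<open>x \<bullet> q - c - \<integral>H(\<tau>, q) d\<tau>\<close> over the affine
  minorants \<open>q \<bullet> y - c\<close> of the initial datum, where the slopes \<open>q\<close> range in a bounded set. Since \<open>H\<close> is
  Lipschitz in time there, \<open>U = u + C t\<^sup>2\<close> has at every point \<open>(t, x)\<close> of the strip a subgradient
  \<open>(2 C t - H(t, q), q)\<close>, with \<open>q\<close> a maximiser; across \<open>t = t1\<close> this persists because minorants of
  the first layer induce minorants of the second one. So \<open>U\<close> is convex, has the same singular points as
  \<open>u\<close>, and at a point of differentiability its gradient lies on the graph
  \<open>p = 2 C t - H(t, q)\<close>. At the singular point \<open>z\<close> the subdifferential is a compact convex set with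
  at least two elements, and the hypothesis on segments yields a frontier point \<open>p0\<close> of it off that
  graph. With \<open>v\<close> an outer normal at \<open>p0\<close>, the arc is the proximal curve: \<open>\<gamma>(s)\<close> minimises
  \<open>U(y) - (p0 + v) \<bullet> (y - z) + |y - z|\<^sup>2 / (2 s)\<close>. Monotonicity makes \<open>\<gamma>\<close> Lipschitz, and
  \<open>(\<gamma>(s) - z) / s\<close> tends to \<open>v \<noteq> 0\<close>, so the subgradient \<open>p0 + v - (\<gamma>(s) - z) / s\<close> at \<open>\<gamma>(s)\<close> tends
  to \<open>p0\<close>; were \<open>U\<close> differentiable at \<open>\<gamma>(s)\<close> for arbitrarily small \<open>s\<close>, then \<open>p0\<close> would lie on
  the graph.
\<close>

section \<open>Subgradients relative to a set\<close>

text \<open>For \<open>z\<close> in \<open>S\<close>, the subdifferential of \<open>U\<close>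
  extended by infinity outside \<open>S\<close>. With \<open>S\<close> explicit, the open strip, a
  single layer and a compact ball are treated alike.\<close>

definition subgrads :: "'b::euclidean_space set \<Rightarrow> ('b \<Rightarrow> real) \<Rightarrow> 'b \<Rightarrow> 'b set" where
  "subgrads S U z = {p. \<forall>y\<in>S. U z + p \<bullet> (y - z) \<le> U y}"

lemma subgradsD: "p \<in> subgrads S U z \<Longrightarrow> y \<in> S \<Longrightarrow> U z + p \<bullet> (y - z) \<le> U y"
  by (simp add: subgrads_def)

lemma subgrads_mono: "K \<subseteq> S \<Longrightarrow> subgrads S U z \<subseteq> subgrads K U z"
  by (auto simp: subgrads_def)

lemma subgrads_monotone:
  assumes "p \<in> subgrads S U x" "q \<in> subgrads S U y" "x \<in> S" "y \<in> S"
  shows "0 \<le> (p - q) \<bullet> (x - y)"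
  using subgradsD[OF assms(1,4)] subgradsD[OF assms(2,3)]
  by (simp add: inner_diff_left inner_diff_right)

lemma subgrads_closed_graph:
  assumes "continuous_on S U" "z \<in> S"
    and "\<And>n. x n \<in> S" "\<And>n. p n \<in> subgrads S U (x n)"
    and "x \<longlonglongrightarrow> z" "p \<longlonglongrightarrow> q"
  shows "q \<in> subgrads S U z"
  unfolding subgrads_def
proof (intro CollectI ballI)
  fix y assume "y \<in> S"
  have "(\<lambda>n. U (x n)) \<longlonglongrightarrow> U z"
    using assms continuous_on_tendsto_compose[of S U x z sequentially] by auto
  then have "(\<lambda>n. U (x n) + p n \<bullet> (y - x n)) \<longlonglongrightarrow> U z + q \<bullet> (y - z)"
    by (intro tendsto_intros assms)
  moreover have "U (x n) + p n \<bullet> (y - x n) \<le> U y" for n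
    using subgradsD[OF assms(4) \<open>y \<in> S\<close>] .
  ultimately show "U z + q \<bullet> (y - z) \<le> U y"
    by (intro LIMSEQ_le_const2) auto
qed

lemma closed_subgrads: "closed (subgrads S U z)"
proof -
  have "subgrads S U z = (\<Inter>y\<in>S. {p. U z + p \<bullet> (y - z) \<le> U y})"
    by (auto simp: subgrads_def)
  moreover have "closed {p. U z + p \<bullet> (y - z) \<le> U y}" for y
    by (intro closed_Collect_le continuous_intros)
  ultimately show ?thesis by auto
qed

lemma convex_subgrads: "convex (subgrads S U z)"
proof (rule convexI)
  fix p q and a b :: real
  assume pq: "p \<in> subgrads S U z" "q \<in> subgrads S U z" and ab: "0 \<le> a" "0 \<le> b" "a + b = 1"
  show "a *\<^sub>R p + b *\<^sub>R q \<in> subgrads S U z"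
    unfolding subgrads_def
  proof (intro CollectI ballI)
    fix y assume "y \<in> S"
    then have "a * (p \<bullet> (y - z)) + b * (q \<bullet> (y - z)) \<le> a * (U y - U z) + b * (U y - U z)"
      using pq ab by (intro add_mono mult_left_mono) (auto dest: subgradsD)
    also have "\<dots> = U y - U z"
      using ab by (metis distrib_right mult_1)
    finally show "U z + (a *\<^sub>R p + b *\<^sub>R q) \<bullet> (y - z) \<le> U y"
      by (simp add: inner_add_left)
  qed
qed

text \<open>The support at the convex combination \<open>w\<close> bounds both endpoint values from
  below; averaging the bounds cancels the linear terms.\<close>

lemma convex_on_if_subgrads:
  assumes "convex S" "\<And>z. z \<in> S \<Longrightarrow> subgrads S U z \<noteq> {}"
  shows "convex_on S U"
  unfolding convex_on_def
proof (intro conjI ballI allI impI assms(1))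
  fix x y and a b :: real
  assume *: "x \<in> S" "y \<in> S" "0 \<le> a" "0 \<le> b" "a + b = 1"
  define w where "w = a *\<^sub>R x + b *\<^sub>R y"
  have "w \<in> S" using * assms(1) by (auto simp: w_def convex_def)
  then obtain p where p: "p \<in> subgrads S U w" using assms(2) by blast
  have "a * (U w + p \<bullet> (x - w)) + b * (U w + p \<bullet> (y - w)) \<le> a * U x + b * U y"
    using * p by (intro add_mono mult_left_mono) (auto dest: subgradsD)
  moreover have "a * (U w + p \<bullet> (x - w)) + b * (U w + p \<bullet> (y - w)) 
     = (a + b) * U w + p \<bullet> (a *\<^sub>R x + b *\<^sub>R y - (a + b) *\<^sub>R w)"
    by (simp add: algebra_simps inner_diff_right inner_add_right)
  ultimately show "U (a *\<^sub>R x + b *\<^sub>R y) \<le> a * U x + b * U y"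
    using * by (simp add: w_def[symmetric])
qed

text \<open>\<open>U\<close> minus the linear form \<open>p\<close> is minimal at \<open>z\<close>
  over the open set \<open>S\<close>, so \<open>p\<close> represents the derivative of
  \<open>U\<close> at \<open>z\<close>.\<close>

lemma subgrads_unique:
  assumes "U differentiable (at z)" "open S" "z \<in> S"
    and "p \<in> subgrads S U z" "q \<in> subgrads S U z"
  shows "p = q"
proof -
  obtain D where D: "(U has_derivative D) (at z)"
    using assms(1) by (auto simp: differentiable_def)
  have *: "D h = p \<bullet> h" if "p \<in> subgrads S U z" for p h
  proof -
    have "((\<lambda>y. U y - p \<bullet> y) has_derivative (\<lambda>h. D h - p \<bullet> h)) (at z)"
      by (intro derivative_intros D)
    moreover have "\<forall>y\<in>S. U z - p \<bullet> z \<le> U y - p \<bullet> y"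
      using that by (auto dest!: subgradsD simp: inner_diff_right)
    ultimately have "(\<lambda>h. D h - p \<bullet> h) = (\<lambda>h. 0)"
      using differential_zero_maxmin[of z S] assms(2,3) by blast
    then show ?thesis by (meson eq_iff_diff_eq_0)
  qed
  then show ?thesis using assms(4,5) by (metis vector_eq_ldot inner_commute)
qed

section \<open>Existence of proximal points\<close>

text \<open>First-order optimality for a minimiser of the proximal functional \<open>F\<close>.
  Comparison runs along segments inside \<open>K\<close>, so the minimiser may lie on the boundary
  of \<open>K\<close>.\<close>

lemma prox_exists:
  assumes "compact K" "convex_on K U" "continuous_on K U" "K \<noteq> {}" "0 < s"
  shows "\<exists>x\<in>K. p - (x - z) /\<^sub>R s \<in> subgrads K U x"
proof -
  define F where "F y = U y - p \<bullet> (y - z) + (norm (y - z))\<^sup>2 / (2 * s)" for y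
  have "continuous_on K F"
    unfolding F_def by (intro continuous_intros assms) (use assms in auto)
  then obtain x where x: "x \<in> K" "\<And>y. y \<in> K \<Longrightarrow> F x \<le> F y"
    using continuous_attains_inf[of K F] assms by blast
  have "U x + (p - (x - z) /\<^sub>R s) \<bullet> (y - x) \<le> U y" if "y \<in> K" for y
  proof -
    \<comment> \<open>\<open>A\<close> is the slack in the subgradient inequality at
      \<open>y\<close>, to be shown nonnegative; \<open>B\<close> is the second-order cost of moving
      along the segment.\<close>
    define A where "A = U y - U x - (p - (x - z) /\<^sub>R s) \<bullet> (y - x)"
    have Aeq: "A = U y - U x - p \<bullet> (y - x) + (x - z) \<bullet> (y - x) / s"
      unfolding A_def by (simp add: inner_diff_left[of p] divide_inverse mult.commute)
    define B where "B = (norm (y - x))\<^sup>2 / (2 * s)"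
    \<comment> \<open>Along the segment \<open>F\<close> grows by at most
      \<open>l * (A + l * B)\<close>; minimality of \<open>x\<close> makes this nonnegative, and
      \<open>l\<close> will tend to 0.\<close>
    have "0 \<le> A + l * B" if l: "0 < l" "l \<le> 1" for l
    proof -
      define w where "w = (1 - l) *\<^sub>R x + l *\<^sub>R y"
      have "w \<in> K" using assms(2) l x(1) \<open>y \<in> K\<close>
        by (auto simp: w_def convex_on_def convex_def)
      have Uw: "U w \<le> (1 - l) * U x + l * U y"
        using assms(2) l x(1) \<open>y \<in> K\<close> by (auto simp: w_def convex_on_def)
      have w: "w - z = (x - z) + l *\<^sub>R (y - x)"
        by (simp add: w_def algebra_simps)
      have n: "(norm (w - z))\<^sup>2 = (norm (x - z))\<^sup>2 + 2 * l * ((x - z) \<bullet> (y - x)) + l\<^sup>2 * (norm (y - x))\<^sup>2"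
        unfolding w power2_norm_eq_inner
        by (simp add: inner_add_left inner_add_right power2_eq_square inner_commute algebra_simps)
      have pw: "p \<bullet> (w - z) = p \<bullet> (x - z) + l * (p \<bullet> (y - x))"
        unfolding w by (simp add: inner_add_right)
      have "F w = U w - p \<bullet> (x - z) - l * (p \<bullet> (y - x)) 
         + (norm (x - z))\<^sup>2 / (2 * s) + l * ((x - z) \<bullet> (y - x)) / s + l * l * B"
        unfolding F_def n pw B_def using \<open>0 < s\<close>
        by (simp add: field_simps power2_eq_square)
      then have "F w \<le> F x + l * A + l * l * B"
        using Uw unfolding Aeq F_def by (simp add: ring_distribs)
      then have "0 \<le> l * (A + l * B)"
        using x(2)[OF \<open>w \<in> K\<close>] by (simp add: algebra_simps)
      then show ?thesis using l by (simp add: zero_le_mult_iff)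
    qed
    then have "\<forall>\<^sub>F l in at_right 0. 0 \<le> A + l * B"
      by (auto simp: eventually_at_right_field intro!: exI[of _ 1])
    moreover have "((\<lambda>l. A + l * B) \<longlongrightarrow> A + 0 * B) (at_right 0)"
      by (intro tendsto_intros)
    ultimately have "0 \<le> A + 0 * B"
      by (intro tendsto_lowerbound) auto
    then show ?thesis by (simp add: A_def)
  qed
  then show ?thesis using x(1) by (auto simp: subgrads_def)
qed


section \<open>Bounds, non-uniqueness and normals of the subdifferential\<close>

text \<open>The inequality is tested at distance \<open>r\<close> from \<open>z\<close> in the
  direction of \<open>p\<close> itself, where the linear term equals
  \<open>r * norm p\<close>.\<close>

lemma subgrads_bounded:
  assumes "cball z r \<subseteq> S" "0 < r" "0 \<le> B" "\<And>y. y \<in> S \<Longrightarrow> U y - U z \<le> B * norm (y - z)"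
    and "p \<in> subgrads S U z"
  shows "norm p \<le> B"
proof (cases "p = 0")
  case True
  then show ?thesis using \<open>0 \<le> B\<close> by simp
next
  case False
  define y where "y = z + (r / norm p) *\<^sub>R p"
  have n: "norm (y - z) = r" using False assms(2) by (simp add: y_def)
  then have "y \<in> S" using assms(1) by (auto simp: dist_norm norm_minus_commute)
  then have "p \<bullet> (y - z) \<le> B * r"
    using assms(4)[of y] subgradsD[OF assms(5), of y] n by auto
  moreover have "p \<bullet> (y - z) = r * norm p"
    using False by (simp add: y_def dot_square_norm power2_eq_square)
  ultimately show ?thesis using assms(2) by (simp add: mult.commute)
qed

text \<open>As \<open>p\<close> is not a gradient, there are points \<open>y n\<close> tending to
  \<open>z\<close> with linearisation error above \<open>e * norm (y n - z)\<close>. Subgradients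
  there stay at distance at least \<open>e\<close> from \<open>p\<close>, and a limit of them is a
  second subgradient at \<open>z\<close>.\<close>

lemma subgrads_two:
  assumes "open S" "z \<in> S" "\<not> U differentiable (at z)" "continuous_on S U"
    and sel: "\<And>y. y \<in> S \<Longrightarrow> \<exists>p\<in>subgrads S U y. norm p \<le> B"
  shows "\<exists>a\<in>subgrads S U z. \<exists>b\<in>subgrads S U z. a \<noteq> b"
proof -
  obtain p where p: "p \<in> subgrads S U z" using sel[OF assms(2)] by blast
  have "bounded_linear (\<lambda>h. p \<bullet> h)" by (rule bounded_linear_inner_right)
  moreover have "\<not> (U has_derivative (\<lambda>h. p \<bullet> h)) (at z)"
    using assms(3) by (auto simp: differentiable_def)
  ultimately obtain e where e: "0 < e"
    "\<And>d. 0 < d \<Longrightarrow> \<exists>y. norm (y - z) < d \<and> \<not> norm (U y - U z - p \<bullet> (y - z)) \<le> e * norm (y - z)"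
    unfolding has_derivative_at_alt by blast
  obtain r where r: "0 < r" "ball z r \<subseteq> S" using assms(1,2) openE by blast
  have "\<exists>y. y \<in> S \<and> norm (y - z) < inverse (real (Suc n)) 
           \<and> \<not> norm (U y - U z - p \<bullet> (y - z)) \<le> e * norm (y - z)" for n
    using e(2)[of "min r (inverse (real (Suc n)))"] r
    by (auto simp: subset_iff dist_norm norm_minus_commute)
  then obtain y where y: "\<And>n. y n \<in> S" "\<And>n. norm (y n - z) < inverse (real (Suc n))"
    "\<And>n. \<not> norm (U (y n) - U z - p \<bullet> (y n - z)) \<le> e * norm (y n - z)" by metis
  have "\<forall>n. \<exists>q. q \<in> subgrads S U (y n) \<and> norm q \<le> B" using sel y(1) by blast
  then obtain q where q: "\<And>n. q n \<in> subgrads S U (y n)" "\<And>n. norm (q n) \<le> B" by metis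
  have "y \<longlonglongrightarrow> z"
  proof -
    have "(\<lambda>n. norm (y n - z)) \<longlonglongrightarrow> 0"
      by (rule tendsto_sandwich[OF _ _ tendsto_const LIMSEQ_inverse_real_of_nat])
        (use y(2) in \<open>auto intro!: always_eventually less_imp_le\<close>)
    then show ?thesis by (simp add: LIM_zero_iff tendsto_norm_zero_iff)
  qed
  have far: "e \<le> norm (q n - p)" for n
  proof -
    have "e * norm (y n - z) < U (y n) - U z - p \<bullet> (y n - z)"
      using y(3)[of n] subgradsD[OF p y(1)[of n]] by auto
    also have "\<dots> \<le> (q n - p) \<bullet> (y n - z)"
      using subgradsD[OF q(1) assms(2), of n] by (simp add: inner_diff_left inner_diff_right)
    also have "\<dots> \<le> norm (q n - p) * norm (y n - z)"
      by (rule norm_cauchy_schwarz)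
    finally show ?thesis
      using mult_right_mono[of "norm (q n - p)" e "norm (y n - z)"] by force
  qed
  have "\<forall>n. q n \<in> cball 0 B" using q(2) by simp
  then obtain l k where lk: "strict_mono (k::nat \<Rightarrow> nat)" "(q \<circ> k) \<longlonglongrightarrow> l"
    using compact_cball[of "0::'a" B] unfolding compact_def by blast
  have "l \<in> subgrads S U z"
    by (rule subgrads_closed_graph[OF assms(4,2), of "y \<circ> k" "q \<circ> k"])
      (use y q lk \<open>y \<longlonglongrightarrow> z\<close> in \<open>auto simp: LIMSEQ_subseq_LIMSEQ\<close>)
  moreover have "e \<le> norm (l - p)"
    by (rule tendsto_lowerbound[of "\<lambda>n. norm ((q \<circ> k) n - p)" _ sequentially])
       (use lk far in \<open>auto intro!: tendsto_intros simp: o_def\<close>)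
  ultimately show ?thesis using p e(1) by (intro bexI[of _ l] bexI[of _ p]) auto
qed

text \<open>Without interior, \<open>P\<close> lies in a hyperplane whose normal serves; otherwise a
  supporting hyperplane at a relative frontier point does.\<close>

lemma frontier_normal:
  fixes P :: "'b::euclidean_space set"
  assumes "convex P" "closed P" "p \<in> frontier P"
  obtains v where "v \<noteq> 0" "\<And>q. q \<in> P \<Longrightarrow> v \<bullet> (q - p) \<le> 0"
proof (cases "interior P = {}")
  case True
  then obtain a b where ab: "a \<noteq> 0" "P \<subseteq> {x. a \<bullet> x = b}"
    using empty_interior_subset_hyperplane[OF assms(1)] by blast
  moreover have "p \<in> P" using assms by (auto simp: frontier_def)
  ultimately show ?thesis by (intro that[of a]) (auto simp: inner_diff_right subset_iff)
next
  case False
  then have "rel_interior P = interior P"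
    using rel_interior_nonempty_interior by blast
  then have "p \<in> closure P" "p \<notin> rel_interior P"
    using assms(3) by (simp_all add: frontier_def)
  then obtain a where a: "a \<noteq> 0" "\<And>y. y \<in> closure P \<Longrightarrow> a \<bullet> p \<le> a \<bullet> y"
    using supporting_hyperplane_relative_frontier[OF assms(1)] by metis
  have "- a \<bullet> (q - p) \<le> 0" if "q \<in> P" for q
    using a(2)[of q] that closure_subset[of P] by (auto simp: inner_diff_right)
  then show ?thesis using a(1) by (intro that[of "-a"]) simp_all
qed

section \<open>The proximal curve near its starting point\<close>

text \<open>Monotonicity of subgradients between \<open>x s\<close> and \<open>z\<close> gives the
  first bound; between \<open>x s\<close> and \<open>x r\<close> it gives the second, into which the
  first is fed.\<close>

lemma prox_lipschitz:
  fixes x :: "real \<Rightarrow> 'b::euclidean_space"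
  assumes z: "z \<in> K" and p0: "p0 \<in> subgrads K U z"
    and x: "\<And>s. 0 < s \<Longrightarrow> x s \<in> K"
      "\<And>s. 0 < s \<Longrightarrow> p0 + v - (x s - z) /\<^sub>R s \<in> subgrads K U (x s)"
  shows "0 < s \<Longrightarrow> norm (x s - z) \<le> norm v * s"
    and "0 < r \<Longrightarrow> r \<le> s \<Longrightarrow> norm (x s - x r) \<le> norm v * (s - r)"
proof -
  show *: "norm (x s - z) \<le> norm v * s" if "0 < s" for s
  proof -
    define d where "d = (x s - z) /\<^sub>R s"
    have xd: "x s - z = s *\<^sub>R d" using that by (simp add: d_def)
    have "0 \<le> (p0 + v - d - p0) \<bullet> (x s - z)"
      using subgrads_monotone[OF x(2)[OF that] p0 x(1)[OF that] z] by (simp add: d_def)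
    then have "d \<bullet> d \<le> v \<bullet> d"
      using that by (simp add: xd inner_diff_left zero_le_mult_iff)
    also have "\<dots> \<le> norm v * norm d" by (rule norm_cauchy_schwarz)
    finally have "norm d \<le> norm v"
      by (cases "d = 0") (auto simp: dot_square_norm power2_eq_square)
    then show ?thesis using that by (simp add: xd mult.commute)
  qed
  show "norm (x s - x r) \<le> norm v * (s - r)" if "0 < r" "r \<le> s"
  proof -
    have "0 < s" using that by simp
    define a b where "a = x s - z" and "b = x r - z"
    have ab: "x s - x r = a - b" by (simp add: a_def b_def)
    have "0 \<le> (b /\<^sub>R r - a /\<^sub>R s) \<bullet> (a - b)"
      using subgrads_monotone[OF x(2)[OF \<open>0 < s\<close>] x(2)[OF \<open>0 < r\<close>] x(1)[OF \<open>0 < s\<close>] x(1)[OF \<open>0 < r\<close>]]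
      by (simp add: ab) (simp add: a_def b_def)
    \<comment> \<open>Multiplying by \<open>r * s\<close> clears the denominators; the rewriting
      below then isolates \<open>r * (norm (a - b))\<^sup>2\<close> against a term with factor
      \<open>s - r\<close>.\<close>
    then have "0 \<le> (r * s) * ((b /\<^sub>R r - a /\<^sub>R s) \<bullet> (a - b))"
      using \<open>0 < r\<close> \<open>0 < s\<close> by simp
    also have "\<dots> = (s *\<^sub>R b - r *\<^sub>R a) \<bullet> (a - b)"
      using \<open>0 < r\<close> \<open>0 < s\<close> by (simp add: inner_diff_left inner_diff_right field_simps)
    also have "s *\<^sub>R b - r *\<^sub>R a = (s - r) *\<^sub>R b - r *\<^sub>R (a - b)"
      by (simp add: algebra_simps)
    finally have "r * (norm (a - b))\<^sup>2 \<le> (s - r) * (b \<bullet> (a - b))"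
      by (simp add: inner_diff_left power2_norm_eq_inner)
    also have "\<dots> \<le> (s - r) * (norm b * norm (a - b))"
      using that by (intro mult_left_mono norm_cauchy_schwarz) auto
    also have "\<dots> \<le> (s - r) * (norm v * r * norm (a - b))"
      using that *[of r] by (intro mult_left_mono mult_right_mono) (auto simp: b_def)
    finally have "r * (norm (a - b) * norm (a - b)) \<le> r * (norm v * (s - r) * norm (a - b))"
      by (simp add: power2_eq_square algebra_simps)
    then have "norm (a - b) * norm (a - b) \<le> norm v * (s - r) * norm (a - b)"
      using \<open>0 < r\<close> by simp
    then show ?thesis
      unfolding ab using that by (cases "a = b") auto
  qed
qed

text \<open>A limit \<open>l\<close> of the quotients makes \<open>p0 + v - l\<close> a subgradient
  at \<open>z\<close>. Normality gives \<open>(v - l) \<bullet> v \<le> 0\<close> and monotonicity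
  \<open>0 \<le> (v - l) \<bullet> l\<close>, which force \<open>l = v\<close>. Geometrically,
  \<open>p0\<close> is the projection of \<open>p0 + v\<close> onto the subdifferential.\<close>

lemma prox_subgrad_tendsto:
  fixes x :: "real \<Rightarrow> 'b::euclidean_space"
  assumes K: "continuous_on K U" and z: "z \<in> K" and p0: "p0 \<in> subgrads K U z"
    and v: "\<And>q. q \<in> subgrads K U z \<Longrightarrow> v \<bullet> (q - p0) \<le> 0"
    and x: "\<And>s. 0 < s \<Longrightarrow> x s \<in> K"
      "\<And>s. 0 < s \<Longrightarrow> p0 + v - (x s - z) /\<^sub>R s \<in> subgrads K U (x s)"
  shows "((\<lambda>s. (x s - z) /\<^sub>R s) \<longlongrightarrow> v) (at_right 0)"
proof (rule ccontr)
  assume "\<not> ?thesis"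
  then obtain e where e: "0 < e" "\<not> (\<forall>\<^sub>F s in at_right 0. dist ((x s - z) /\<^sub>R s) v < e)"
    unfolding tendsto_iff by blast
  have "\<exists>s. 0 < s \<and> s < inverse (real (Suc n)) \<and> e \<le> dist ((x s - z) /\<^sub>R s) v" for n
  proof (rule ccontr)
    assume "\<not> ?thesis"
    then have "\<forall>\<^sub>F s in at_right 0. dist ((x s - z) /\<^sub>R s) v < e"
      unfolding eventually_at_right_field by (intro exI[of _ "inverse (real (Suc n))"]) (auto simp: not_le)
    then show False using e(2) by blast
  qed
  then obtain s where s: "\<And>n. 0 < s n" "\<And>n. s n < inverse (real (Suc n))"
    "\<And>n. e \<le> dist ((x (s n) - z) /\<^sub>R s n) v" by metis
  define d where "d n = (x (s n) - z) /\<^sub>R s n" for n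
  have s0: "s \<longlonglongrightarrow> 0"
    by (rule tendsto_sandwich[OF _ _ tendsto_const LIMSEQ_inverse_real_of_nat])
      (use s in \<open>auto intro!: always_eventually less_imp_le\<close>)
  have xd: "x (s n) = z + s n *\<^sub>R d n" for n using s(1)[of n] by (simp add: d_def)
  have dn: "norm (d n) \<le> norm v" for n
    using prox_lipschitz(1)[OF z p0 x s(1)[of n]] s(1)[of n]
    by (simp add: xd mult.commute)
  then have "\<forall>n. d n \<in> cball 0 (norm v)" by simp
  then obtain l k where lk: "strict_mono (k::nat \<Rightarrow> nat)" "(d \<circ> k) \<longlonglongrightarrow> l"
    using compact_cball[of "0::'b" "norm v"] unfolding compact_def by blast
  have sk: "(s \<circ> k) \<longlonglongrightarrow> 0" using s0 lk(1) by (rule LIMSEQ_subseq_LIMSEQ)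
  have "(\<lambda>n. z + (s \<circ> k) n *\<^sub>R (d \<circ> k) n) \<longlonglongrightarrow> z + 0 *\<^sub>R l"
    by (intro tendsto_intros lk sk)
  then have xk: "(\<lambda>n. x (s (k n))) \<longlonglongrightarrow> z" by (simp add: xd)
  have "(\<lambda>n. p0 + v - (d \<circ> k) n) \<longlonglongrightarrow> p0 + v - l"
    by (intro tendsto_intros lk)
  from subgrads_closed_graph[OF K z _ _ xk this]
  have l: "p0 + v - l \<in> subgrads K U z" using x s(1) by (auto simp: d_def)
  have "0 \<le> (v - d n) \<bullet> d n" for n
  proof -
    have "0 \<le> (p0 + v - d n - p0) \<bullet> (x (s n) - z)"
      using subgrads_monotone[OF x(2)[OF s(1)] p0 x(1)[OF s(1)] z, of n] by (simp add: d_def)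
    then show ?thesis using s(1)[of n] by (simp add: xd zero_le_mult_iff)
  qed
  moreover have "(\<lambda>n. (v - (d \<circ> k) n) \<bullet> (d \<circ> k) n) \<longlonglongrightarrow> (v - l) \<bullet> l"
    by (intro tendsto_intros lk)
  ultimately have "0 \<le> (v - l) \<bullet> l" by (intro LIMSEQ_le_const) auto
  moreover have "(v - l) \<bullet> v \<le> 0"
    using v[OF l] by (simp add: inner_commute)
  ultimately have "(v - l) \<bullet> (v - l) \<le> 0" by (simp add: inner_diff_right)
  then have "l = v"
    by (metis antisym inner_eq_zero_iff inner_ge_zero right_minus_eq)
  moreover have "e \<le> dist l v"
    by (rule tendsto_lowerbound[of "\<lambda>n. dist ((d \<circ> k) n) v" _ sequentially])
       (use lk s(3) in \<open>auto intro!: tendsto_intros simp: o_def d_def\<close>)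
  ultimately show False using e(1) by simp
qed

section \<open>Singular arcs of functions with subgradients in a closed set\<close>

text \<open>\<open>G\<close> abstracts the pairs of a point and an admissible gradient. At a point
  of differentiability the selected subgradient is the only one, so such points are avoided by a
  curve along which the pairs of point and subgradient tend to some \<open>(z, p0)\<close> outside
  the closed set \<open>G\<close>.\<close>

theorem singular_arc:
  fixes U :: "'b::euclidean_space \<Rightarrow> real" and G :: "('b \<times> 'b) set"
  assumes S: "open S" "convex S" and z: "z \<in> S" and G: "closed G" and B: "0 \<le> B"
    and sel: "\<And>y. y \<in> S \<Longrightarrow> \<exists>p\<in>subgrads S U y. (y, p) \<in> G \<and> norm p \<le> B"
    and sing: "\<not> U differentiable (at z)"
    and exit: "\<And>P. compact P \<Longrightarrow> convex P \<Longrightarrow> (\<exists>a\<in>P. \<exists>b\<in>P. a \<noteq> b) \<Longrightarrow> \<exists>p\<in>frontier P. (z, p) \<notin> G"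
  shows "\<exists>\<rho>>0. \<exists>\<gamma> :: real \<Rightarrow> 'b. (\<exists>L. L-lipschitz_on {0..\<rho>} \<gamma>) \<and> \<gamma> 0 = z
         \<and> (\<forall>s\<in>{0<..<\<rho>}. \<gamma> s \<in> S \<and> \<not> U differentiable (at (\<gamma> s)) \<and> \<gamma> s \<noteq> z)"
proof -
  have grow: "U y - U x \<le> B * norm (y - x)" if "x \<in> S" "y \<in> S" for x y
  proof -
    obtain p where p: "p \<in> subgrads S U y" "norm p \<le> B" using sel \<open>y \<in> S\<close> by blast
    have "U y - U x \<le> p \<bullet> (y - x)"
      using subgradsD[OF p(1) \<open>x \<in> S\<close>] by (simp add: inner_diff_right)
    also have "\<dots> \<le> norm p * norm (y - x)" by (rule norm_cauchy_schwarz)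
    also have "\<dots> \<le> B * norm (y - x)" by (intro mult_right_mono p) auto
    finally show ?thesis .
  qed
  have "convex_on S U"
    using sel S(2) by (intro convex_on_if_subgrads) auto
  have cont: "continuous_on S U"
    by (rule convex_on_continuous[OF S(1) \<open>convex_on S U\<close>])
  obtain r where r: "0 < r" "cball z r \<subseteq> S" using S(1) z open_contains_cball by blast
  \<comment> \<open>Proximal minimisers exist on the compact ball \<open>K\<close>. Passing from
    \<open>S\<close> to \<open>K\<close> can only enlarge the subdifferential, so \<open>P\<close>
    below inherits two distinct elements.\<close>
  define K where "K = cball z r"
  have K: "compact K" "convex_on K U" "continuous_on K U" "z \<in> K" "K \<subseteq> S"
    using r \<open>convex_on S U\<close> cont
    by (auto simp: K_def intro: convex_on_subset continuous_on_subset)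
  define P where "P = subgrads K U z"
  have "convex P" "closed P" by (simp_all add: P_def convex_subgrads closed_subgrads)
  have "norm p \<le> B" if "p \<in> P" for p
  proof (rule subgrads_bounded[of z r K B U])
    show "U y - U z \<le> B * norm (y - z)" if "y \<in> K" for y
      using grow[OF z] that K(5) by blast
  qed (use that r B in \<open>auto simp: P_def K_def\<close>)
  then have "compact P"
    using \<open>closed P\<close> by (auto simp: compact_eq_bounded_closed bounded_iff)
  have "\<exists>a\<in>subgrads S U z. \<exists>b\<in>subgrads S U z. a \<noteq> b"
    using subgrads_two[OF S(1) z sing cont] sel by blast
  then have "\<exists>a\<in>P. \<exists>b\<in>P. a \<noteq> b"
    using subgrads_mono[OF K(5), of U z] unfolding P_def by blast
  then obtain p0 where p0: "p0 \<in> frontier P" "(z, p0) \<notin> G"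
    using exit \<open>compact P\<close> \<open>convex P\<close> by blast
  then obtain v where v: "v \<noteq> 0" "\<And>q. q \<in> P \<Longrightarrow> v \<bullet> (q - p0) \<le> 0"
    using frontier_normal[OF \<open>convex P\<close> \<open>closed P\<close>] by metis
  have "p0 \<in> P" using p0(1) \<open>closed P\<close> by (auto simp: frontier_def)
  then have p0K: "p0 \<in> subgrads K U z" by (simp add: P_def)
  have "\<exists>x. 0 < s \<longrightarrow> x \<in> K \<and> p0 + v - (x - z) /\<^sub>R s \<in> subgrads K U x" for s
    using prox_exists[OF K(1-3), of s "p0 + v" z] K(4) by blast
  then obtain x where "\<And>s. 0 < s \<longrightarrow> x s \<in> K \<and> p0 + v - (x s - z) /\<^sub>R s \<in> subgrads K U (x s)"
    by metis
  then have x: "\<And>s. 0 < s \<Longrightarrow> x s \<in> K"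
      "\<And>s. 0 < s \<Longrightarrow> p0 + v - (x s - z) /\<^sub>R s \<in> subgrads K U (x s)"
    by auto
  note lip = prox_lipschitz[OF K(4) p0K x]
  have d: "((\<lambda>s. (x s - z) /\<^sub>R s) \<longlongrightarrow> v) (at_right 0)"
    by (rule prox_subgrad_tendsto[OF K(3,4) p0K v(2) x]) (auto simp: P_def)
  have pos: "\<forall>\<^sub>F s in at_right (0::real). 0 < s" by (simp add: eventually_at_right_less)
  have "((\<lambda>s. z + s *\<^sub>R ((x s - z) /\<^sub>R s)) \<longlongrightarrow> z + 0 *\<^sub>R v) (at_right 0)"
    by (intro tendsto_intros d)
  moreover have "\<forall>\<^sub>F s in at_right 0. z + s *\<^sub>R ((x s - z) /\<^sub>R s) = x s"
    using pos by (rule eventually_mono) simp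
  ultimately have xz: "(x \<longlongrightarrow> z) (at_right 0)"
    using Lim_transform_eventually by force
  have g: "((\<lambda>s. p0 + v - (x s - z) /\<^sub>R s) \<longlongrightarrow> p0 + v - v) (at_right 0)"
    by (intro tendsto_intros d)
  have "((\<lambda>s. (x s, p0 + v - (x s - z) /\<^sub>R s)) \<longlongrightarrow> (z, p0)) (at_right 0)"
    using tendsto_Pair[OF xz g] by simp
  moreover have "open (- G)" "(z, p0) \<in> - G" using G p0(2) by auto
  ultimately have "\<forall>\<^sub>F s in at_right 0. (x s, p0 + v - (x s - z) /\<^sub>R s) \<in> - G"
    by (rule topological_tendstoD)
  moreover have "\<forall>\<^sub>F s in at_right 0. x s \<in> ball z r"
    using r by (intro topological_tendstoD[OF xz]) auto
  moreover have "\<forall>\<^sub>F s in at_right 0. (x s - z) /\<^sub>R s \<in> - {0}"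
    using v(1) by (intro topological_tendstoD[OF d]) auto
  ultimately have "\<forall>\<^sub>F s in at_right 0. x s \<in> S \<and> \<not> U differentiable (at (x s)) \<and> x s \<noteq> z"
    using pos
  proof eventually_elim
    case (elim s)
    have "x s \<in> S" using elim K(5) by (auto simp: K_def)
    have "\<not> U differentiable (at (x s))"
    proof
      assume diff: "U differentiable (at (x s))"
      obtain p where p: "p \<in> subgrads S U (x s)" "(x s, p) \<in> G"
        using sel[OF \<open>x s \<in> S\<close>] by blast
      \<comment> \<open>Uniqueness of subgradients is available on open sets, so both are restricted
        to the open ball containing \<open>x s\<close>.\<close>
      have sub: "ball z r \<subseteq> K" by (auto simp: K_def)
      have "p \<in> subgrads (ball z r) U (x s)"
        using p(1) subgrads_mono[OF order_trans[OF sub K(5)]] by blast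
      moreover have "p0 + v - (x s - z) /\<^sub>R s \<in> subgrads (ball z r) U (x s)"
        using x(2)[OF \<open>0 < s\<close>] subgrads_mono[OF sub] by blast
      ultimately have "p = p0 + v - (x s - z) /\<^sub>R s"
        using subgrads_unique[OF diff open_ball \<open>x s \<in> ball z r\<close>] by blast
      then show False using p(2) elim by simp
    qed
    then show ?case using \<open>x s \<in> S\<close> elim by auto
  qed
  then obtain \<rho> where \<rho>: "0 < \<rho>"
    "\<And>s. 0 < s \<Longrightarrow> s < \<rho> \<Longrightarrow> x s \<in> S \<and> \<not> U differentiable (at (x s)) \<and> x s \<noteq> z"
    by (auto simp: eventually_at_right_field)
  \<comment> \<open>\<open>x\<close> is controlled only for positive parameters; the starting point
    is inserted by hand.\<close>
  define \<gamma> where "\<gamma> s = (if s = 0 then z else x s)" for s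
  have le: "norm (\<gamma> s - \<gamma> r) \<le> norm v * (s - r)" if "0 \<le> r" "r \<le> s" for r s
    using lip(1)[of s] lip(2)[of r s] that by (auto simp: \<gamma>_def)
  have "(norm v)-lipschitz_on {0..\<rho>} \<gamma>"
  proof (rule lipschitz_onI)
    fix s r assume "s \<in> {0..\<rho>}" "r \<in> {0..\<rho>}"
    then show "dist (\<gamma> s) (\<gamma> r) \<le> norm v * dist s r"
      using le[of r s] le[of s r]
      by (cases "r \<le> s") (auto simp: dist_norm norm_minus_commute)
  qed simp
  then have "\<exists>L. L-lipschitz_on {0..\<rho>} \<gamma>" by blast
  moreover have "\<gamma> 0 = z" by (simp add: \<gamma>_def)
  moreover have "\<forall>s\<in>{0<..<\<rho>}. \<gamma> s \<in> S \<and> \<not> U differentiable (at (\<gamma> s)) \<and> \<gamma> s \<noteq> z"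
    using \<rho> by (simp add: \<gamma>_def)
  ultimately show ?thesis using \<rho>(1) by blast
qed

section \<open>Compact convex sets and graphs\<close>

text \<open>Without interior, \<open>P\<close> is its own frontier and contains a segment, which the
  graph does not. Otherwise the line through an interior point in the direction of the first axis
  meets the frontier twice, and the graph contains at most one of these points.\<close>

lemma frontier_outside_graph:
  fixes P :: "(real \<times> 'a::euclidean_space) set"
  assumes P: "compact P" "convex P" and ab: "a \<in> P" "b \<in> P" "a \<noteq> b"
    and flat: "\<And>a b. a \<noteq> b \<Longrightarrow> \<not> closed_segment a b \<subseteq> {p. fst p = h (snd p)}"
  shows "\<exists>p\<in>frontier P. fst p \<noteq> h (snd p)"
proof (cases "interior P = {}")
  case True
  then have "frontier P = P" 
    using P(1) by (simp add: frontier_def compact_imp_closed)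
  moreover have "closed_segment a b \<subseteq> P" using P(2) ab by (simp add: closed_segment_subset)
  ultimately show ?thesis using flat[OF ab(3)] by blast
next
  case False
  then obtain c q where cq: "(c, q) \<in> interior P" by fastforce
  define l where "l = {s. (s, q) \<in> P}"
  have "l = fst ` (P \<inter> (UNIV \<times> {q}))" by (force simp: l_def)
  moreover have "compact (P \<inter> (UNIV \<times> {q}))"
    using P(1) by (intro compact_Int_closed closed_Times) auto
  ultimately have "compact l"
    by (auto intro!: compact_continuous_image continuous_intros)
  have "c \<in> l" using cq interior_subset by (auto simp: l_def)
  obtain m M where mM: "m \<in> l" "M \<in> l" "\<And>s. s \<in> l \<Longrightarrow> m \<le> s \<and> s \<le> M"
    using compact_attains_inf[OF \<open>compact l\<close>] compact_attains_sup[OF \<open>compact l\<close>] \<open>c \<in> l\<close> by blast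
  obtain e where e: "0 < e" "cball (c, q) e \<subseteq> P"
    using cq mem_interior_cball by blast
  have ball_l: "s + d \<in> l" if "cball (s, q) e' \<subseteq> P" "\<bar>d\<bar> \<le> e'" for s d e' :: real
    using that by (auto simp: l_def subset_iff dist_Pair_Pair dist_real_def)
  \<comment> \<open>An interior point could be moved by \<open>e'\<close> both ways within the slice
    \<open>l\<close>, past its extreme value.\<close>
  have not_int: "(s, q) \<notin> interior P" if "s = m \<or> s = M" for s
  proof
    assume "(s, q) \<in> interior P"
    then obtain e' where e': "0 < e'" "cball (s, q) e' \<subseteq> P"
      using mem_interior_cball by blast
    have "s + e' \<in> l" using e'(1) by (intro ball_l[OF e'(2)]) simp
    moreover have "s + - e' \<in> l" using e'(1) by (intro ball_l[OF e'(2)]) simp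
    ultimately have "s + e' \<le> M" "m \<le> s + - e'" using mM(3) by blast+
    then show False using that e'(1) by auto
  qed
  have "c + e \<in> l" using e(1) by (intro ball_l[OF e(2)]) auto
  then have "m < M" using mM(3)[OF \<open>c + e \<in> l\<close>] mM(3)[OF \<open>c \<in> l\<close>] e(1) by linarith
  have "(m, q) \<in> closure P" "(M, q) \<in> closure P"
    using mM(1,2) closure_subset[of P] by (auto simp: l_def)
  then have *: "(m, q) \<in> frontier P" "(M, q) \<in> frontier P"
    using not_int[of m] not_int[of M] by (simp_all add: frontier_def)
  show ?thesis
  proof (cases "m = h q")
    case True
    then show ?thesis using *(2) \<open>m < M\<close> by (intro bexI[of _ "(M, q)"]) simp_all
  next
    case False
    then show ?thesis using *(1) by (intro bexI[of _ "(m, q)"]) simp_all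
  qed
qed

section \<open>The Hopf formula as a maximum over affine minorants\<close>

text \<open>Along the ray through \<open>q\<close> the minorant grows at rate
  \<open>norm q * norm q\<close>, but \<open>w\<close> at most at rate
  \<open>L * norm q\<close>.\<close>

lemma lipschitz_minorant_slope:
  fixes w :: "'a::euclidean_space \<Rightarrow> real"
  assumes lip: "L-lipschitz_on UNIV w" and minor: "\<And>y. q \<bullet> y - c \<le> w y"
  shows "norm q \<le> L"
proof (rule ccontr)
  assume "\<not> norm q \<le> L"
  moreover have "0 \<le> L" using lip by (rule lipschitz_on_nonneg)
  ultimately have pos: "0 < norm q * (norm q - L)" by (intro mult_pos_pos) auto
  \<comment> \<open>Chosen to overshoot the resulting bound \<open>w 0 + c\<close> by exactly
    one.\<close>
  define s where "s = (w 0 + c + 1) / (norm q * (norm q - L))"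
  have "0 \<le> w 0 + c" using minor[of 0] by simp
  then have "0 \<le> s" using pos by (simp add: s_def)
  have "q \<bullet> (s *\<^sub>R q) - c \<le> w (s *\<^sub>R q)" by (rule minor)
  also have "\<dots> \<le> w 0 + L * norm (s *\<^sub>R q)"
    using lipschitz_onD[OF lip, of "s *\<^sub>R q" 0] by (auto simp: dist_norm)
  finally have "s * (norm q * (norm q - L)) \<le> w 0 + c"
    using \<open>0 \<le> s\<close> by (simp add: dot_square_norm power2_eq_square algebra_simps)
  moreover have "s * (norm q * (norm q - L)) = w 0 + c + 1"
    using pos unfolding s_def by (metis less_irrefl nonzero_divide_eq_eq)
  ultimately show False by simp
qed

text \<open>\<open>A\<close> is the epigraph of the conjugate of \<open>w\<close>; its real pairs
  avoid infinite values. The supremum is attained because slopes are bounded by \<open>L\<close> and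
  a large \<open>c\<close> cannot compete.\<close>

lemma hopf_eq_max:
  fixes w :: "'a::euclidean_space \<Rightarrow> real" and H :: "real \<Rightarrow> 'a \<Rightarrow> real"
  defines "A \<equiv> {(q, c). \<forall>y. q \<bullet> y - c \<le> w y}"
  assumes lip: "L-lipschitz_on UNIV w" and A: "A \<noteq> {}"
    and cont: "continuous_on (cball 0 L) (\<lambda>q. integral {s..t} (\<lambda>\<tau>. H \<tau> q))"
  obtains q c where "(q, c) \<in> A" "hopf w H s t x = x \<bullet> q - c - integral {s..t} (\<lambda>\<tau>. H \<tau> q)"
    "\<And>q' c'. (q', c') \<in> A \<Longrightarrow> x \<bullet> q' - c' - integral {s..t} (\<lambda>\<tau>. H \<tau> q') \<le> hopf w H s t x"
proof -
  define J where "J q = integral {s..t} (\<lambda>\<tau>. H \<tau> q)" for q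
  define F where "F = (\<lambda>(q, c). x \<bullet> q - c - J q)"
  have "A = (\<Inter>y. {p. fst p \<bullet> y - snd p \<le> w y})" by (auto simp: A_def)
  moreover have "closed {p::'a \<times> real. fst p \<bullet> y - snd p \<le> w y}" for y
    by (intro closed_Collect_le continuous_intros)
  ultimately have "closed A" by auto
  have nq: "norm q \<le> L" if "(q, c) \<in> A" for q c
    using lipschitz_minorant_slope[OF lip] that by (auto simp: A_def)
  have "0 \<le> L" using lip by (rule lipschitz_on_nonneg)
  have contJ: "continuous_on (cball 0 L) J" using cont by (simp add: J_def[abs_def])
  obtain a0 where a0: "a0 \<in> A" using A by blast
  obtain M where M: "\<And>q. q \<in> cball 0 L \<Longrightarrow> \<bar>J q\<bar> \<le> M"
    using compact_imp_bounded[OF compact_continuous_image[OF contJ compact_cball]]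
    unfolding bounded_iff by (metis imageI real_norm_def)
  \<comment> \<open>Pairs doing at least as well as \<open>a0\<close> have \<open>c \<le> R\<close>,
    and the minorant at \<open>y = 0\<close> gives \<open>- w 0 \<le> c\<close>. So maximising over
    the compact \<open>A'\<close> suffices.\<close>
  define R where "R = norm x * L + M - F a0"
  define A' where "A' = A \<inter> (cball 0 L \<times> {- w 0..R})"
  have A'I: "a \<in> A'" if "a \<in> A" "F a0 \<le> F a" for a
  proof (cases a)
    case (Pair q c)
    have "x \<bullet> q \<le> norm x * norm q" by (rule norm_cauchy_schwarz)
    also have "\<dots> \<le> norm x * L" using nq that(1) Pair by (intro mult_left_mono) auto
    finally have "c \<le> R"
      using that(2) M[of q] nq[of q c] that(1) by (auto simp: F_def Pair R_def)
    moreover have "- w 0 \<le> c" using that(1) by (auto simp: A_def Pair dest: spec[of _ 0])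
    ultimately show ?thesis using that(1) nq by (auto simp: A'_def Pair)
  qed
  have "compact A'"
    unfolding A'_def using \<open>closed A\<close>
    by (intro closed_Int_compact compact_Times) auto
  moreover have "continuous_on A' F"
    unfolding F_def case_prod_unfold
    by (intro continuous_intros continuous_on_compose2[OF contJ]) (auto simp: A'_def)
  moreover have "a0 \<in> A'" using A'I[OF a0] by simp
  ultimately obtain m where m: "m \<in> A'" "\<And>a. a \<in> A' \<Longrightarrow> F a \<le> F m"
    using continuous_attains_sup[of A' F] by blast
  have mA: "m \<in> A" using m(1) by (simp add: A'_def)
  have max: "F a \<le> F m" if "a \<in> A" for a
    using A'I[OF that] m(2)[OF \<open>a0 \<in> A'\<close>] m(2)[of a] by linarith
  define W where "W = fconj (\<lambda>y. ereal (w y))"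
  have W_le: "W q \<le> ereal c" if "(q, c) \<in> A" for q c
    unfolding W_def fconj_def using that by (auto simp: A_def intro!: SUP_least simp: algebra_simps)
  have W_ge: "ereal (q \<bullet> y - w y) \<le> W q" for q y
    unfolding W_def fconj_def by (rule SUP_upper2[of y]) auto
  have "fconj (\<lambda>q. W q + ereal (J q)) x = ereal (F m)"
  proof (rule antisym)
    show "fconj (\<lambda>q. W q + ereal (J q)) x \<le> ereal (F m)"
      unfolding fconj_def
    proof (rule SUP_least)
      fix q :: 'a
      show "ereal (x \<bullet> q) - (W q + ereal (J q)) \<le> ereal (F m)"
      \<comment> \<open>A finite \<open>W q\<close> is itself an admissible \<open>c\<close>; the
        value infinity contributes minus infinity, and minus infinity is excluded by
        \<open>W_ge\<close>.\<close>
      proof (cases "W q")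
        case (real c)
        have "(q, c) \<in> A" using W_ge[of q] by (auto simp: real A_def algebra_simps)
        from max[OF this] show ?thesis by (simp add: real F_def)
      next
        case PInf
        then show ?thesis by simp
      next
        case MInf
        then show ?thesis using W_ge[of q 0] by simp
      qed
    qed
    obtain q c where qc: "m = (q, c)" by (cases m)
    have "ereal (F m) \<le> ereal (x \<bullet> q) - (W q + ereal (J q))"
      using W_le[of q c] W_ge[of q 0] mA by (cases "W q") (auto simp: qc F_def)
    also have "\<dots> \<le> fconj (\<lambda>q. W q + ereal (J q)) x"
      unfolding fconj_def by (rule SUP_upper) auto
    finally show "ereal (F m) \<le> fconj (\<lambda>q. W q + ereal (J q)) x" .
  qed
  then have "hopf w H s t x = F m"
    by (simp add: hopf_def W_def J_def)
  then show ?thesis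
    using mA max by (intro that[of "fst m" "snd m"]) (auto simp: F_def J_def case_prod_unfold)
qed

section \<open>Tangent and Lipschitz estimates for the data\<close>

text \<open>Restriction to the line through \<open>x\<close> and \<open>y\<close> reduces this to
  the one-dimensional tangent inequality; \<open>adjoint D 1\<close> represents \<open>D\<close> as
  an inner product.\<close>

lemma differentiable_convex_minorant:
  fixes f :: "'a::euclidean_space \<Rightarrow> real"
  assumes "convex_on UNIV f" "(f has_derivative D) (at x)"
  obtains g where "\<And>y. f x + g \<bullet> (y - x) \<le> f y"
proof
  interpret D: bounded_linear D using assms(2) by (rule has_derivative_bounded_linear)
  fix y
  define \<phi> where "\<phi> s = f (x + s *\<^sub>R (y - x))" for s
  have "convex_on UNIV \<phi>"
  proof (rule convex_onI)
    fix t s r :: real assume "0 < t" "t < 1"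
    moreover have "x + ((1 - t) *\<^sub>R s + t *\<^sub>R r) *\<^sub>R (y - x) 
      = (1 - t) *\<^sub>R (x + s *\<^sub>R (y - x)) + t *\<^sub>R (x + r *\<^sub>R (y - x))"
      by (simp add: algebra_simps)
    ultimately show "\<phi> ((1 - t) *\<^sub>R s + t *\<^sub>R r) \<le> (1 - t) * \<phi> s + t * \<phi> r"
      using convex_onD[OF assms(1), of t] by (simp add: \<phi>_def)
  qed simp
  moreover have "(\<phi> has_field_derivative D (y - x)) (at 0)"
  proof -
    have "((\<lambda>s. x + s *\<^sub>R (y - x)) has_derivative (\<lambda>s. s *\<^sub>R (y - x))) (at 0)"
      by (auto intro!: derivative_eq_intros)
    moreover have "(f has_derivative D) (at (x + 0 *\<^sub>R (y - x)))" using assms(2) by simp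
    ultimately have "(\<phi> has_derivative (\<lambda>s. D (s *\<^sub>R (y - x)))) (at 0)"
      unfolding \<phi>_def by (rule has_derivative_compose)
    then show ?thesis
      by (simp add: has_field_derivative_def D.scaleR mult.commute[of _ "D (y - x)"])
  qed
  ultimately have "D (y - x) * (1 - 0) \<le> \<phi> 1 - \<phi> 0"
    by (intro convex_on_imp_above_tangent[of UNIV]) auto
  moreover have "D (y - x) = adjoint D 1 \<bullet> (y - x)"
    using adjoint_works[OF D.linear_axioms, of "y - x" 1] by (simp add: inner_commute)
  ultimately show "f x + adjoint D 1 \<bullet> (y - x) \<le> f y" by (simp add: \<phi>_def)
qed

lemma C1_on_lipschitz:
  assumes "C1_on S f" "compact K" "convex K" "K \<subseteq> S"
  obtains C where "0 \<le> C" "\<And>x y. x \<in> K \<Longrightarrow> y \<in> K \<Longrightarrow> \<bar>f x - f y\<bar> \<le> C * norm (x - y)"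
proof -
  obtain f' where f': "\<And>z. z \<in> S \<Longrightarrow> (f has_derivative blinfun_apply (f' z)) (at z within S)"
    "continuous_on S f'" using assms(1) by (auto simp: C1_on_def)
  have "bounded (f' ` K)"
    using assms f'(2) by (intro compact_imp_bounded compact_continuous_image)
      (auto intro: continuous_on_subset)
  then obtain C where C: "\<And>z. z \<in> K \<Longrightarrow> norm (f' z) \<le> C"
    unfolding bounded_iff by (metis imageI)
  show ?thesis
  \<comment> \<open>If \<open>K\<close> is empty, \<open>C\<close> may be negative.\<close>
  proof (rule that[of "max C 0"])
    fix x y assume xy: "x \<in> K" "y \<in> K"
    have "norm (f x - f y) \<le> max C 0 * norm (x - y)"
    proof (rule differentiable_bound[OF assms(3) _ _ xy])
      show "(f has_derivative blinfun_apply (f' z)) (at z within K)" if "z \<in> K" for z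
        using f'(1)[of z] that assms(4) has_derivative_subset by blast
      show "onorm (blinfun_apply (f' z)) \<le> max C 0" if "z \<in> K" for z
        using C[OF that] by (simp add: norm_blinfun.rep_eq)
    qed
    then show "\<bar>f x - f y\<bar> \<le> max C 0 * norm (x - y)" by simp
  qed simp
qed

text \<open>The mean value theorem gives the increment \<open>f s * (t' - t)\<close>, and the
  Lipschitz bound replaces \<open>f s\<close> by \<open>f t\<close>. The quadratic error is what the
  term added to \<open>u\<close> will absorb.\<close>

lemma lipschitz_integral_taylor:
  fixes f :: "real \<Rightarrow> real"
  assumes lip: "\<And>r s. r \<in> {0..T} \<Longrightarrow> s \<in> {0..T} \<Longrightarrow> \<bar>f r - f s\<bar> \<le> C * \<bar>r - s\<bar>"
    and C: "0 \<le> C" and cont: "continuous_on {0..T} f" and t: "t \<in> {0..T}" "t' \<in> {0..T}"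
  shows "integral {0..t'} f \<le> integral {0..t} f + f t * (t' - t) + C * (t' - t)\<^sup>2"
proof -
  define F where "F t = integral {0..t} f" for t
  have deriv: "(F has_derivative (\<lambda>h. f s * h)) (at s within {a..b})"
    if "s \<in> {a..b}" "{a..b} \<subseteq> {0..T}" for s a b
    using integral_has_real_derivative[OF cont, of s] that has_field_derivative_subset[of F "f s" s "{0..T}"]
    unfolding F_def has_field_derivative_def by blast
  have "\<exists>s. s \<in> {min t t'..max t t'} \<and> F t' - F t = f s * (t' - t)"
  proof (cases "t = t'")
    case False
    then have "min t t' < max t t'" by auto
    then have "\<exists>s\<in>{min t t'<..<max t t'}. F (max t t') - F (min t t') = f s * (max t t' - min t t')"
      using t by (intro mvt_simple[where f' = "\<lambda>s h. f s * h"] deriv) auto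
    then obtain s where "s\<in>{min t t'<..<max t t'}" "F (max t t') - F (min t t') = f s * (max t t' - min t t')"
      by blast
    then show ?thesis
      by (intro exI[of _ s]) (auto simp: max_def min_def algebra_simps split: if_splits)
  qed auto
  then obtain s where s: "s \<in> {min t t'..max t t'}" "F t' - F t = f s * (t' - t)" by blast
  have "(f s - f t) * (t' - t) \<le> \<bar>f s - f t\<bar> * \<bar>t' - t\<bar>"
    by (metis abs_ge_self abs_mult)
  also have "\<dots> \<le> C * \<bar>s - t\<bar> * \<bar>t' - t\<bar>"
    using s(1) t by (intro mult_right_mono lip) (auto simp: min_def max_def split: if_splits)
  also have "\<dots> \<le> C * \<bar>t' - t\<bar> * \<bar>t' - t\<bar>"
    using s(1) C by (intro mult_right_mono mult_left_mono) (auto simp: min_def max_def split: if_splits)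
  finally show ?thesis
    using s(2) by (simp add: F_def algebra_simps power2_eq_square)
qed

section \<open>Gluing the two layers\<close>

text \<open>A support of \<open>U\<close> at \<open>z\<close> relative to one layer is global, provided that every segment leaving the
  layer crosses its boundary at a point \<open>w \<noteq> z\<close> with a global support.\<close>

lemma subgrads_cross:
  assumes p: "p \<in> subgrads K U z" and q: "q \<in> subgrads S U w" and "K \<subseteq> S" "z \<in> K" "w \<in> K" "y \<in> S"
    and w: "w = z + m *\<^sub>R (y - z)" "0 < m" "m \<le> 1"
  shows "U z + p \<bullet> (y - z) \<le> U y"
proof -
  have "0 \<le> (q - p) \<bullet> (w - z)"
    using subgrads_monotone[of q K U w p z] subgrads_mono[OF \<open>K \<subseteq> S\<close>, of U w] assms by blast
  then have "0 \<le> (q - p) \<bullet> (y - z)"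
    using w by (simp add: zero_le_mult_iff)
  then have "(1 - m) * (p \<bullet> (y - z)) \<le> (1 - m) * (q \<bullet> (y - z))"
    using w(3) by (intro mult_left_mono) (auto simp: inner_diff_left)
  moreover have "U z + p \<bullet> (w - z) \<le> U w" "U w + q \<bullet> (y - w) \<le> U y"
    using p q assms(4-6) by (auto dest: subgradsD)
  moreover have "w - z = m *\<^sub>R (y - z)" "y - w = (1 - m) *\<^sub>R (y - z)"
    by (simp_all add: w algebra_simps)
  ultimately show ?thesis by (simp add: left_diff_distrib)
qed

text \<open>A maximiser at \<open>x\<close> competes at \<open>y\<close>, so the increment is at
  most \<open>q \<bullet> (x - y)\<close>. Keeping the constant \<open>L\<close> gives both layers
  the same slope bound.\<close>

lemma hopf_lipschitz:
  fixes w :: "'a::euclidean_space \<Rightarrow> real" and H :: "real \<Rightarrow> 'a \<Rightarrow> real"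
  assumes lip: "L-lipschitz_on UNIV w" and A: "{(q, c). \<forall>y. q \<bullet> y - c \<le> w y} \<noteq> {}"
    and cont: "continuous_on (cball 0 L) (\<lambda>q. integral {s..t} (\<lambda>\<tau>. H \<tau> q))"
  shows "L-lipschitz_on UNIV (\<lambda>x. hopf w H s t x)"
proof (rule lipschitz_onI)
  show "0 \<le> L" using lip by (rule lipschitz_on_nonneg)
  have le: "hopf w H s t x - hopf w H s t y \<le> L * norm (x - y)" for x y
  proof -
    obtain q c where qc: "\<And>y. q \<bullet> y - c \<le> w y"
      "hopf w H s t x = x \<bullet> q - c - integral {s..t} (\<lambda>\<tau>. H \<tau> q)"
      by (rule hopf_eq_max[OF lip A cont, of x]) auto
    have "y \<bullet> q - c - integral {s..t} (\<lambda>\<tau>. H \<tau> q) \<le> hopf w H s t y"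
      by (rule hopf_eq_max[OF lip A cont, of y]) (use qc(1) in auto)
    then have "hopf w H s t x - hopf w H s t y \<le> q \<bullet> (x - y)"
      using qc(2) by (simp add: inner_diff_right inner_commute)
    also have "\<dots> \<le> norm q * norm (x - y)" by (rule norm_cauchy_schwarz)
    also have "\<dots> \<le> L * norm (x - y)"
      using lipschitz_minorant_slope[OF lip qc(1)] by (intro mult_right_mono) auto
    finally show ?thesis .
  qed
  show "dist (hopf w H s t x) (hopf w H s t y) \<le> L * dist x y" for x y
    using le[of x y] le[of y x] by (auto simp: dist_norm norm_minus_commute abs_le_iff)
qed

text \<open>A maximiser yields a function \<open>V q c\<close> touching \<open>u\<close> from below
  at \<open>(t, x)\<close>. Up to time \<open>t1\<close> it stays below \<open>u\<close> on the
  whole strip; later it does so on the second layer, and the resulting support is extended across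
  \<open>t1\<close>.\<close>

lemma layered_subgrads:
  fixes H :: "real \<Rightarrow> 'a::euclidean_space \<Rightarrow> real" and \<sigma> :: "'a \<Rightarrow> real"
  assumes T: "0 < t1" "t1 < T"
    and lip: "L-lipschitz_on UNIV \<sigma>" and A: "{(q, c). \<forall>y. q \<bullet> y - c \<le> \<sigma> y} \<noteq> {}"
    and contH: "continuous_on ({0..T} \<times> UNIV) (\<lambda>(t, p). H t p)" and "0 \<le> C"
    and Hlip: "\<And>q s r. norm q \<le> L \<Longrightarrow> s \<in> {0..T} \<Longrightarrow> r \<in> {0..T} \<Longrightarrow> \<bar>H s q - H r q\<bar> \<le> C * \<bar>s - r\<bar>"
    and t: "t \<in> {0..T}"
  shows "\<exists>q. norm q \<le> L \<and> (2 * C * t - H t q, q) 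
    \<in> subgrads ({0..T} \<times> UNIV) (\<lambda>z. layered_sol H \<sigma> t1 z + C * (fst z)\<^sup>2) (t, x)"
proof -
  define u where "u = layered_sol H \<sigma> t1"
  define U where "U z = u z + C * (fst z)\<^sup>2" for z
  define J where "J q t = integral {0..t} (\<lambda>\<tau>. H \<tau> q)" for q t
  define V where "V q c = (\<lambda>(t, x). x \<bullet> q - c - J q t)" for q c
  define \<omega> where "\<omega> = hopf \<sigma> H 0 t1"
  have contHq: "continuous_on {0..T} (\<lambda>\<tau>. H \<tau> q)" for q
  proof -
    have "continuous_on {0..T} (\<lambda>\<tau>. (\<lambda>(t, p). H t p) (\<tau>, q))"
      by (rule continuous_on_compose2[OF contH]) (auto intro!: continuous_intros)
    then show ?thesis by simp
  qed
  have contJ: "continuous_on (cball 0 L) (\<lambda>q. integral {s..t} (\<lambda>\<tau>. H \<tau> q))" if "0 \<le> s" "t \<le> T" for s t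
  proof -
    have "continuous_on (cball 0 L \<times> cbox s t) (\<lambda>z. (\<lambda>(t, p). H t p) (snd z, fst z))"
      by (rule continuous_on_compose2[OF contH]) (use that in \<open>auto intro!: continuous_intros\<close>)
    then have "continuous_on (cball 0 L \<times> cbox s t) (\<lambda>(q, \<tau>). H \<tau> q)"
      by (simp add: case_prod_unfold)
    then show ?thesis using integral_continuous_on_param by fastforce
  qed
  have touch: "(2 * C * t - H t q, q) \<in> subgrads S U (t, x)"
    if q: "norm q \<le> L" and S: "S \<subseteq> {0..T} \<times> UNIV" and t: "t \<in> {0..T}"
      and eq: "u (t, x) = V q c (t, x)" and le: "\<And>z. z \<in> S \<Longrightarrow> V q c z \<le> u z" for q S t x c
    unfolding subgrads_def
  proof (intro CollectI ballI)
    fix z assume "z \<in> S"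
    moreover obtain t' x' where z: "z = (t', x')" by fastforce
    ultimately have t': "t' \<in> {0..T}" using S by auto
    have J: "J q t' \<le> J q t + H t q * (t' - t) + C * (t' - t)\<^sup>2"
      unfolding J_def using Hlip[OF q] \<open>0 \<le> C\<close> contHq t t'
      by (intro lipschitz_integral_taylor[where T = T]) auto
    \<comment> \<open>Expansion of \<open>C * t'\<^sup>2\<close> at \<open>t\<close>; its remainder
      cancels the error term in \<open>J\<close>.\<close>
    have sq: "C * t\<^sup>2 + 2 * C * t * (t' - t) + C * (t' - t)\<^sup>2 = C * t'\<^sup>2"
      by (simp add: algebra_simps power2_eq_square)
    have "U (t, x) + (2 * C * t - H t q, q) \<bullet> (z - (t, x)) 
        = V q c (t, x) + C * t\<^sup>2 + 2 * C * t * (t' - t) - H t q * (t' - t) + q \<bullet> (x' - x)"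
      by (simp add: U_def eq z algebra_simps)
    also have "\<dots> = x' \<bullet> q - c - J q t - H t q * (t' - t) - C * (t' - t)\<^sup>2 + C * t'\<^sup>2"
      unfolding sq[symmetric] by (simp add: V_def inner_diff_right inner_commute)
    also have "\<dots> \<le> V q c z + C * t'\<^sup>2"
      using J by (simp add: V_def z)
    also have "\<dots> \<le> U z" using le[OF \<open>z \<in> S\<close>] by (simp add: U_def z)
    finally show "U (t, x) + (2 * C * t - H t q, q) \<bullet> (z - (t, x)) \<le> U z" .
  qed
  have J_split: "integral {t1..s} (\<lambda>\<tau>. H \<tau> q) = J q s - J q t1" if "t1 \<le> s" "s \<le> T" for s q
  proof -
    have "continuous_on {0..s} (\<lambda>\<tau>. H \<tau> q)"
      using continuous_on_subset[OF contHq] that by auto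
    then have "integral {0..t1} (\<lambda>\<tau>. H \<tau> q) + integral {t1..s} (\<lambda>\<tau>. H \<tau> q) = J q s"
      unfolding J_def using T that
      by (intro Henstock_Kurzweil_Integration.integral_combine integrable_continuous_interval) auto
    then show ?thesis by (simp add: J_def)
  qed
  have u_lo: "u (s, y) = hopf \<sigma> H 0 s y" if "s \<le> t1" for s y
    using that by (simp add: u_def layered_sol_def)
  have u_hi: "u (s, y) = hopf \<omega> H t1 s y" if "t1 < s" for s y
    using that by (simp add: u_def layered_sol_def \<omega>_def)
  have lo: "V q c (s, y) \<le> u (s, y)" if "\<forall>y. q \<bullet> y - c \<le> \<sigma> y" "s \<in> {0..t1}" for q c s y
    by (rule hopf_eq_max[OF lip A contJ, of 0 s y])
       (use that T in \<open>auto simp: V_def J_def u_lo\<close>)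
  have \<omega>_minor: "q \<bullet> y - (c + J q t1) \<le> \<omega> y" if "\<forall>y. q \<bullet> y - c \<le> \<sigma> y" for q c y
    using lo[OF that, of t1 y] T by (simp add: V_def u_lo \<omega>_def inner_commute)
  have lip\<omega>: "L-lipschitz_on UNIV \<omega>"
    unfolding \<omega>_def using T by (intro hopf_lipschitz[OF lip A] contJ) auto
  have A\<omega>: "{(q, c). \<forall>y. q \<bullet> y - c \<le> \<omega> y} \<noteq> {}"
    using A \<omega>_minor by blast
  \<comment> \<open>\<open>V\<close> integrates from time 0 but the second layer from
    \<open>t1\<close>; the shift of \<open>c\<close> by \<open>J q t1\<close> makes up for
    this.\<close>
  have hi: "V q (c - J q t1) (s, y) \<le> u (s, y)" if "\<forall>y. q \<bullet> y - c \<le> \<omega> y" "s \<in> {t1..T}" for q c s y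
  proof (cases "s = t1")
    case True
    then show ?thesis using that(1) by (simp add: V_def u_lo \<omega>_def inner_commute[of y q])
  next
    case False
    then have s: "t1 < s" "s \<le> T" using that(2) by auto
    have "y \<bullet> q - c - integral {t1..s} (\<lambda>\<tau>. H \<tau> q) \<le> hopf \<omega> H t1 s y"
      by (rule hopf_eq_max[OF lip\<omega> A\<omega> contJ, of t1 s y]) (use that(1) s T in auto)
    then show ?thesis using s by (simp add: V_def u_hi J_split)
  qed
  \<comment> \<open>A minorant of \<open>\<sigma>\<close> becomes at \<open>t1\<close> one of
    \<open>\<omega>\<close> with \<open>c\<close> raised by \<open>J q t1\<close>, and
    \<open>hi\<close> undoes the shift, so the same \<open>V q c\<close> serves both layers.\<close>
  have glob: "V q c z \<le> u z" if "\<forall>y. q \<bullet> y - c \<le> \<sigma> y" "z \<in> {0..T} \<times> UNIV" for q c z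
    using lo[OF that(1), of "fst z" "snd z"] hi[of q "c + J q t1" "fst z" "snd z"] \<omega>_minor[OF that(1)] that(2)
    by (cases "fst z \<le> t1") auto
  have low: "\<exists>q. norm q \<le> L \<and> (2 * C * t - H t q, q) \<in> subgrads ({0..T} \<times> UNIV) U (t, x)"
    if "t \<in> {0..t1}" for t x
  proof -
    have t: "0 \<le> t" "t \<le> t1" using that by auto
    obtain q c where qc: "\<forall>y. q \<bullet> y - c \<le> \<sigma> y" "u (t, x) = V q c (t, x)"
      by (rule hopf_eq_max[OF lip A contJ, of 0 t x]) (use t T in \<open>auto simp: V_def J_def u_lo\<close>)
    moreover have "norm q \<le> L" using lipschitz_minorant_slope[OF lip] qc(1) by blast
    ultimately show ?thesis
      using that T glob by (intro exI[of _ q] conjI touch[of q _ t x c]) auto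
  qed
  have "\<exists>q. norm q \<le> L \<and> (2 * C * t - H t q, q) \<in> subgrads ({0..T} \<times> UNIV) U (t, x)"
  proof (cases "t \<le> t1")
    case True
    then show ?thesis using low t by simp
  next
    case False
    then have t: "t1 < t" "t \<le> T" using t by auto
    obtain q c where qc: "\<forall>y. q \<bullet> y - c \<le> \<omega> y" "u (t, x) = V q (c - J q t1) (t, x)"
      by (rule hopf_eq_max[OF lip\<omega> A\<omega> contJ, of t1 t x]) (use t T in \<open>auto simp: V_def J_split u_hi\<close>)
    have q: "norm q \<le> L" using lipschitz_minorant_slope[OF lip\<omega>] qc(1) by blast
    define p where "p = (2 * C * t - H t q, q)"
    have p: "p \<in> subgrads ({t1..T} \<times> UNIV) U (t, x)"
      unfolding p_def using qc t T hi by (intro touch[OF q, where c = "c - J q t1"]) auto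
    have "p \<in> subgrads ({0..T} \<times> UNIV) U (t, x)"
      unfolding subgrads_def
    proof (intro CollectI ballI)
      fix z assume z: "z \<in> {0..T} \<times> (UNIV :: 'a set)"
      show "U (t, x) + p \<bullet> (z - (t, x)) \<le> U z"
      proof (cases "t1 \<le> fst z")
        case True
        then show ?thesis using z by (intro subgradsD[OF p]) auto
      next
        case False
        \<comment> \<open>The fraction of the segment from \<open>(t, x)\<close> to \<open>z\<close>
          at which time \<open>t1\<close> is reached; there \<open>low\<close> supplies a global
          support.\<close>
        define m where "m = (t - t1) / (t - fst z)"
        have m: "0 < m" "m \<le> 1" using False t by (auto simp: m_def)
        define w where "w = (t, x) + m *\<^sub>R (z - (t, x))"
        have "fst w = t - m * (t - fst z)" by (simp add: w_def algebra_simps)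
        also have "m * (t - fst z) = t - t1" using False t by (simp add: m_def)
        finally have fw: "fst w = t1" by simp
        obtain q' where "(2 * C * t1 - H t1 q', q') \<in> subgrads ({0..T} \<times> UNIV) U w"
          using low[of t1 "snd w"] T fw by (metis atLeastAtMost_iff less_imp_le order_refl prod.collapse)
        then show ?thesis
          by (rule subgrads_cross[OF p _ _ _ _ z w_def m]) (use t T fw in \<open>auto simp: mem_Times_iff\<close>)
      qed
    qed
    then show ?thesis using q p_def by blast
  qed
  then show ?thesis by (simp add: U_def[abs_def] u_def)
qed

section \<open>Singular arcs of the layered solution\<close>

theorem theorem4p5:
  fixes T t1 t0 :: real and x0 :: "'a::euclidean_space"
    and H :: "real \<Rightarrow> 'a \<Rightarrow> real" and \<sigma> :: "'a \<Rightarrow> real"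
    and u :: "real \<times> 'a \<Rightarrow> real"
  assumes "T > 0" and "0 < t1" and "t1 < T"
    and "C1_on ({0..T} \<times> UNIV) (\<lambda>(t, p). H t p)"
    and "C1_on UNIV \<sigma>" and "convex_on UNIV \<sigma>" and "\<exists>L. L-lipschitz_on UNIV \<sigma>"
    and "condA2 H 0 t1" and "condA2 H t1 T"
    and u_def: "u = layered_sol H \<sigma> t1"
    and "(t0, x0) \<in> Sing T u"
    and "\<not> (\<exists>a b :: real \<times> 'a. a \<noteq> b \<and>
              closed_segment a b \<subseteq> {z. fst z + H t0 (snd z) = 0})"
  shows "\<exists>\<rho>>0. \<exists>\<gamma> :: real \<Rightarrow> real \<times> 'a.
           (\<exists>L. L-lipschitz_on {0..\<rho>} \<gamma>) \<and> \<gamma> 0 = (t0, x0)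
         \<and> (\<forall>s\<in>{0<..<\<rho>}. \<gamma> s \<in> Sing T u)
         \<and> (\<exists>\<delta>>0. \<forall>s\<in>{0<..<\<delta>}. \<gamma> s \<noteq> (t0, x0))"
proof -
  obtain L where lip: "L-lipschitz_on UNIV \<sigma>" using assms(7) by blast
  have "0 \<le> L" using lip by (rule lipschitz_on_nonneg)
  obtain D where "(\<sigma> has_derivative D) (at 0)"
    using assms(5) by (auto simp: C1_on_def)
  then obtain g where "\<And>y. \<sigma> 0 + g \<bullet> (y - 0) \<le> \<sigma> y"
    using differentiable_convex_minorant[OF assms(6)] by blast
  then have "(g, - \<sigma> 0) \<in> {(q, c). \<forall>y. q \<bullet> y - c \<le> \<sigma> y}" by (simp add: add.commute)
  then have A: "{(q, c). \<forall>y. q \<bullet> y - c \<le> \<sigma> y} \<noteq> {}" by blast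
  have contH: "continuous_on ({0..T} \<times> UNIV) (\<lambda>(t, p). H t p)"
    using assms(4) unfolding C1_on_def
    by (meson has_derivative_continuous continuous_on_eq_continuous_within)
  \<comment> \<open>All slopes that occur have norm at most \<open>L\<close>, so constants for
    \<open>H\<close> are needed only over this compact set.\<close>
  define K :: "(real \<times> 'a) set" where "K = {0..T} \<times> cball 0 L"
  have K: "compact K" "convex K" "K \<subseteq> {0..T} \<times> UNIV"
    by (auto simp: K_def intro!: compact_Times convex_Times)
  obtain C where C: "0 \<le> C" and
    lipK: "\<And>x y. x \<in> K \<Longrightarrow> y \<in> K \<Longrightarrow> \<bar>(\<lambda>(t, p). H t p) x - (\<lambda>(t, p). H t p) y\<bar> \<le> C * norm (x - y)"
    using C1_on_lipschitz[OF assms(4) K] by blast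
  have Hlip: "\<bar>H s q - H r q\<bar> \<le> C * \<bar>s - r\<bar>"
    if "norm q \<le> L" "s \<in> {0..T}" "r \<in> {0..T}" for q s r
    using lipK[of "(s, q)" "(r, q)"] that by (simp add: K_def norm_Pair)
  obtain M where M: "\<And>t q. t \<in> {0..T} \<Longrightarrow> norm q \<le> L \<Longrightarrow> \<bar>H t q\<bar> \<le> M"
  proof -
    have "bounded ((\<lambda>(t, p). H t p) ` K)"
      using K contH by (intro compact_imp_bounded compact_continuous_image) (auto intro: continuous_on_subset)
    then obtain M where "\<And>z. z \<in> K \<Longrightarrow> \<bar>(\<lambda>(t, p). H t p) z\<bar> \<le> M"
      unfolding bounded_iff by (metis imageI real_norm_def)
    then have "\<bar>H t q\<bar> \<le> M" if "t \<in> {0..T}" "norm q \<le> L" for t q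
      using that by (force simp: K_def)
    then show ?thesis by (rule that)
  qed
  define U where "U z = u z + C * (fst z)\<^sup>2" for z
  define S :: "(real \<times> 'a) set" where "S = {0<..<T} \<times> UNIV"
  have Sing: "z \<in> Sing T u \<longleftrightarrow> z \<in> S \<and> \<not> U differentiable (at z)" for z
  proof -
    have sq: "(\<lambda>z. C * (fst z)\<^sup>2) differentiable (at z)" for z :: "real \<times> 'a"
      by (intro differentiable_mult differentiable_power differentiable_const
          bounded_linear_imp_differentiable[OF bounded_linear_fst])
    have "U differentiable (at z) \<longleftrightarrow> u differentiable (at z)"
    proof
      assume "U differentiable (at z)"
      then have "(\<lambda>z. U z - C * (fst z)\<^sup>2) differentiable (at z)"
        using sq by (intro differentiable_diff)
      then show "u differentiable (at z)" by (simp add: U_def)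
    next
      assume "u differentiable (at z)"
      then show "U differentiable (at z)"
        unfolding U_def using sq by (intro differentiable_add)
    qed
    then show ?thesis by (simp add: Sing_def S_def)
  qed
  \<comment> \<open>\<open>W\<close> is a closed set of pairs on which \<open>H\<close> is
    continuous, which makes the level set \<open>G\<close> closed.\<close>
  define W :: "((real \<times> 'a) \<times> (real \<times> 'a)) set" where "W = ({0..T} \<times> UNIV) \<times> (UNIV \<times> cball 0 L)"
  define G where "G = {w \<in> W. fst (snd w) - 2 * C * fst (fst w) + H (fst (fst w)) (snd (snd w)) = 0}"
  have "closed G"
    unfolding G_def
  proof (rule continuous_closed_preimage_constant)
    show "closed W" by (auto simp: W_def intro!: closed_Times)
    have "continuous_on W (\<lambda>w. (\<lambda>(t, p). H t p) (fst (fst w), snd (snd w)))"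
      by (rule continuous_on_compose2[OF contH]) (auto simp: W_def intro!: continuous_intros)
    then show "continuous_on W (\<lambda>w. fst (snd w) - 2 * C * fst (fst w) + H (fst (fst w)) (snd (snd w)))"
      by (auto intro!: continuous_intros)
  qed
  have sel: "\<exists>p\<in>subgrads S U z. (z, p) \<in> G \<and> norm p \<le> 2 * C * T + M + L" if "z \<in> S" for z
  proof -
    obtain t x where z: "z = (t, x)" "0 < t" "t < T" using \<open>z \<in> S\<close> by (auto simp: S_def)
    obtain q where q: "norm q \<le> L" "(2 * C * t - H t q, q) \<in> subgrads ({0..T} \<times> UNIV) U (t, x)"
      using layered_subgrads[OF assms(2,3) lip A contH C Hlip, of t x] z
      unfolding U_def[abs_def] u_def by auto
    have "S \<subseteq> {0..T} \<times> UNIV" by (auto simp: S_def)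
    then have "(2 * C * t - H t q, q) \<in> subgrads S U z"
      using q(2) z(1) subgrads_mono by blast
    moreover have "norm (2 * C * t - H t q, q) \<le> 2 * C * T + M + L"
    proof -
      have "norm (2 * C * t - H t q, q) \<le> \<bar>2 * C * t - H t q\<bar> + norm q"
        using norm_Pair_le[of "2 * C * t - H t q" q] by simp
      also have "\<bar>2 * C * t - H t q\<bar> \<le> 2 * C * t + \<bar>H t q\<bar>"
        using C z(2) abs_triangle_ineq4[of "2 * C * t" "H t q"] by simp
      also have "2 * C * t \<le> 2 * C * T" using C z(3) by (intro mult_left_mono) auto
      also have "\<bar>H t q\<bar> \<le> M" using M[of t q] q(1) z by simp
      finally show ?thesis using q(1) by linarith
    qed
    moreover have "(z, (2 * C * t - H t q, q)) \<in> G"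
      using z q(1) by (simp add: G_def W_def)
    ultimately show ?thesis by blast
  qed
  have "0 \<le> 2 * C * T + M + L"
    using C assms(1) M[of 0 0] \<open>0 \<le> L\<close> by (auto intro!: add_nonneg_nonneg)
  have exit: "\<exists>p\<in>frontier P. ((t0, x0), p) \<notin> G"
    if P: "compact P" "convex P" "\<exists>a\<in>P. \<exists>b\<in>P. a \<noteq> b" for P
  proof -
    have "\<not> closed_segment a b \<subseteq> {p. fst p = 2 * C * t0 - H t0 (snd p)}" if "a \<noteq> b" for a b :: "real \<times> 'a"
    proof
      assume sub: "closed_segment a b \<subseteq> {p. fst p = 2 * C * t0 - H t0 (snd p)}"
      \<comment> \<open>Translation by \<open>c\<close> removes the term \<open>2 * C * t0\<close>
        and carries the graph belonging to \<open>U\<close> to the zero level set of the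
        hypothesis.\<close>
      define c :: "real \<times> 'a" where "c = (- (2 * C * t0), 0)"
      have "closed_segment (c + a) (c + b) \<subseteq> {z. fst z + H t0 (snd z) = 0}"
        using sub unfolding closed_segment_translation by (fastforce simp: c_def)
      then show False using assms(12) that by (meson add_left_cancel)
    qed
    then obtain p where "p \<in> frontier P" "fst p \<noteq> 2 * C * t0 - H t0 (snd p)"
      using frontier_outside_graph[OF P(1,2), where h = "\<lambda>q. 2 * C * t0 - H t0 q"] P(3) by blast
    then show ?thesis by (intro bexI[of _ p]) (auto simp: G_def)
  qed
  have z: "(t0, x0) \<in> S" "\<not> U differentiable (at (t0, x0))" using assms(11) Sing by auto
  have S: "open S" "convex S" by (auto simp: S_def intro!: open_Times convex_Times)
  have "\<exists>\<rho>>0. \<exists>\<gamma> :: real \<Rightarrow> real \<times> 'a. (\<exists>L. L-lipschitz_on {0..\<rho>} \<gamma>) \<and> \<gamma> 0 = (t0, x0)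
      \<and> (\<forall>s\<in>{0<..<\<rho>}. \<gamma> s \<in> S \<and> \<not> U differentiable (at (\<gamma> s)) \<and> \<gamma> s \<noteq> (t0, x0))"
    by (rule singular_arc[OF S z(1) \<open>closed G\<close> \<open>0 \<le> 2 * C * T + M + L\<close> _ z(2)])
      (fact sel, fact exit)
  then show ?thesis using Sing by blast
qed

end
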